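(* Let $[X,\mathcal{B},m,\nu]$ be a reversible random walk space and let $\Omega\in\mathcal{B}$ be $m$-connected with $0<\nu(\Omega)<\nu(\Omega_m)<\infty$, and assume $\Omega$ satisfies a $p$-Poincaré inequality for every $p>1$. Then for every $p>1$ $$\left(\frac{\lambda_{m,1}(\Omega)}{p}\right)^p\le\lambda_{m,p}(\Omega)\le\lambda_{m,1}(\Omega),$$ and consequently $$\lim_{p\to1^+}\lambda_{m,p}(\Omega)=\lambda_{m,1}(\Omega)=h_1^m(\Omega).$$
   Context: A random walk $m$ on a measurable space $(X,\mathcal{B})$ ($\mathcal{B}$ countably generated) is a family $(m_x)_{x\in X}$ of probability measures on $\mathcal{B}$ such that $x\mapsto m_x(B)$ is measurable for each $B\in\mathcal{B}$. A $\sigma$-finite measure $\nu$ on $X$ is reversible if $dm_x(y)d\nu(x)=dm_y(x)d\nu(y)$ as measures on $X\times X$; then $[X,\mathcal{B},m,\nu]$ is called a reversible random walk space. For $A,B\in\mathcal{B}$, $L_m(A,B):=\int_A m_x(B)\,d\nu(x)$, and the $m$-perimeter of $E\in\mathcal{B}$ is $P_m(E):=L_m(E,X\setminus E)$. Notation: $d(\nu\otimes m_x)(x,y)=dm_x(y)\,d\nu(x)$ and $\nabla f(x,y):=f(y)-f(x)$. For $\Omega\in\mathcal{B}$: $\partial_m\Omega:=\{x\in X\setminus\Omega: m_x(\Omega)>0\}$ and $\Omega_m:=\Omega\cup\partial_m\Omega$. A set $\Omega\in\mathcal B$ with $\nu(\Omega)>0$ is $m$-connected if $L_m(A,B)>0$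 for all measurable $A,B\subset\Omega$ of positive $\nu$-measure with $A\cup B=\Omega$. For $p\ge1$, $L^p_0(\Omega_m,\nu):=\{f\in L^p(\Omega_m,\nu): f=0\ \nu\text{-a.e. on }\partial_m\Omega\}$. $\Omega$ satisfies a $p$-Poincaré inequality if there is $\lambda>0$ with $\lambda\int_\Omega|f|^pd\nu\le\int_{\Omega_m\times\Omega_m}|\nabla f(x,y)|^p\,d(\nu\otimes m_x)(x,y)$ for all $f\in L^p_0(\Omega_m,\nu)$. For $p\ge1$, $$\lambda_{m,p}(\Omega):=\inf_{f\in L_0^p(\Omega_m,\nu)\setminus\{0\}}\frac{\frac12\int_{\Omega_m\times\Omega_m}|\nabla f(x,y)|^p\,d(\nu\otimes m_x)(x,y)}{\int_\Omega|f|^p\,d\nu}.$$ The $m$-Cheeger constant is $h_1^m(\Omega):=\inf\{P_m(E)/\nu(E): E\in\mathcal{B},\ E\subset\Omega,\ \nu(E)>0\}$. *)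

theory Defs
  imports "HOL-Probability.Probability"
begin

text \<open>
  A measure \<open>\<nu>\<close> carries the whole measurable space: \<open>X = space \<nu>\<close> and \<open>\<B> = sets \<nu>\<close>.
  Integrals of nonnegative functions and the constants derived from them take values
  in \<open>[0, \<infinity>]\<close> (type \<^typ>\<open>ennreal\<close>), so none of them is made finite by convention.
\<close>

text \<open>
  Membership in \<^const>\<open>prob_algebra\<close> says that each \<open>m x\<close> is a probability measure on
  \<open>sets \<nu>\<close>, and measurability that \<open>x \<mapsto> m x B\<close> is measurable for each \<open>B \<in> sets \<nu>\<close>.
\<close>

locale random_walk =
  fixes \<nu> :: "'a measure" and m :: "'a \<Rightarrow> 'a measure"
  assumes countably_generated:
      "\<exists>G. countable G \<and> G \<subseteq> Pow (space \<nu>) \<and> sets \<nu> = sigma_sets (space \<nu>) G"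
    and kernel: "m \<in> measurable \<nu> (prob_algebra \<nu>)"

definition step_measure :: "'a measure \<Rightarrow> ('a \<Rightarrow> 'a measure) \<Rightarrow> ('a \<times> 'a) measure" where
  "step_measure \<nu> m = bind \<nu> (\<lambda>x. distr (m x) (\<nu> \<Otimes>\<^sub>M \<nu>) (Pair x))"

text \<open>
  The measure \<open>\<nu> \<otimes> m\<^sub>x\<close>, that is \<open>dm\<^sub>x(y) d\<nu>(x)\<close>: the monadic definition above amounts to
  the following iterated integral.
\<close>

lemma nn_integral_step_measure:
  assumes "m \<in> measurable \<nu> (prob_algebra \<nu>)" and "f \<in> borel_measurable (\<nu> \<Otimes>\<^sub>M \<nu>)"
  shows "(\<integral>\<^sup>+z. f z \<partial>step_measure \<nu> m) = (\<integral>\<^sup>+x. \<integral>\<^sup>+y. f (x, y) \<partial>m x \<partial>\<nu>)"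
proof -
  have "(\<lambda>x. distr (m x) (\<nu> \<Otimes>\<^sub>M \<nu>) (Pair x)) \<in> measurable \<nu> (prob_algebra (\<nu> \<Otimes>\<^sub>M \<nu>))"
    using assms(1) by (rule measurable_distr_prob_space2) simp
  then have kernel: "(\<lambda>x. distr (m x) (\<nu> \<Otimes>\<^sub>M \<nu>) (Pair x)) \<in> measurable \<nu> (subprob_algebra (\<nu> \<Otimes>\<^sub>M \<nu>))"
    by (rule measurable_prob_algebraD)
  have "(\<integral>\<^sup>+z. f z \<partial>distr (m x) (\<nu> \<Otimes>\<^sub>M \<nu>) (Pair x)) = (\<integral>\<^sup>+y. f (x, y) \<partial>m x)"
    if x: "x \<in> space \<nu>" for x
  proof -
    have "sets (m x) = sets \<nu>"
      using measurable_space[OF assms(1) x] by (simp add: space_prob_algebra)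
    then have "Pair x \<in> measurable (m x) (\<nu> \<Otimes>\<^sub>M \<nu>)"
      using measurable_Pair1'[OF x] by (simp cong: measurable_cong_sets)
    then show ?thesis
      using assms(2) by (intro nn_integral_distr) simp_all
  qed
  then show ?thesis
    unfolding step_measure_def nn_integral_bind[OF assms(2) kernel]
    by (intro nn_integral_cong) simp
qed

locale reversible_random_walk_space = random_walk \<nu> m + sigma_finite_measure \<nu>
  for \<nu> :: "'a measure" and m :: "'a \<Rightarrow> 'a measure" +
  assumes reversible:
    "step_measure \<nu> m = distr (step_measure \<nu> m) (\<nu> \<Otimes>\<^sub>M \<nu>) (\<lambda>(x, y). (y, x))"

definition interaction ::
  "'a measure \<Rightarrow> ('a \<Rightarrow> 'a measure) \<Rightarrow> 'a set \<Rightarrow> 'a set \<Rightarrow> ennreal" where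
  "interaction \<nu> m A B = (\<integral>\<^sup>+x\<in>A. emeasure (m x) B \<partial>\<nu>)"

definition m_perimeter :: "'a measure \<Rightarrow> ('a \<Rightarrow> 'a measure) \<Rightarrow> 'a set \<Rightarrow> ennreal" where
  "m_perimeter \<nu> m E = interaction \<nu> m E (space \<nu> - E)"

definition m_boundary :: "'a measure \<Rightarrow> ('a \<Rightarrow> 'a measure) \<Rightarrow> 'a set \<Rightarrow> 'a set" where
  "m_boundary \<nu> m \<Omega> = {x \<in> space \<nu> - \<Omega>. emeasure (m x) \<Omega> > 0}"

definition m_closure :: "'a measure \<Rightarrow> ('a \<Rightarrow> 'a measure) \<Rightarrow> 'a set \<Rightarrow> 'a set" where
  "m_closure \<nu> m \<Omega> = \<Omega> \<union> m_boundary \<nu> m \<Omega>"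

definition m_connected :: "'a measure \<Rightarrow> ('a \<Rightarrow> 'a measure) \<Rightarrow> 'a set \<Rightarrow> bool" where
  "m_connected \<nu> m \<Omega> \<longleftrightarrow> \<Omega> \<in> sets \<nu> \<and> emeasure \<nu> \<Omega> > 0 \<and>
    (\<forall>A\<in>sets \<nu>. \<forall>B\<in>sets \<nu>. A \<subseteq> \<Omega> \<longrightarrow> B \<subseteq> \<Omega> \<longrightarrow> emeasure \<nu> A > 0 \<longrightarrow> emeasure \<nu> B > 0 \<longrightarrow>
      A \<union> B = \<Omega> \<longrightarrow> interaction \<nu> m A B > 0)"

text \<open>
  Elements of \<open>L\<^sup>p\<close> are represented by functions rather than by classes modulo null sets.
  Their values outside \<open>m_closure \<nu> m \<Omega>\<close> are irrelevant: everything below integrates over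
  \<open>m_closure \<nu> m \<Omega>\<close> only.
\<close>

definition Lp0 :: "'a measure \<Rightarrow> ('a \<Rightarrow> 'a measure) \<Rightarrow> real \<Rightarrow> 'a set \<Rightarrow> ('a \<Rightarrow> real) set" where
  "Lp0 \<nu> m p \<Omega> = {f. f \<in> borel_measurable (restrict_space \<nu> (m_closure \<nu> m \<Omega>)) \<and>
     (\<integral>\<^sup>+x\<in>m_closure \<nu> m \<Omega>. ennreal (\<bar>f x\<bar> powr p) \<partial>\<nu>) < \<infinity> \<and>
     (AE x in \<nu>. x \<in> m_boundary \<nu> m \<Omega> \<longrightarrow> f x = 0)}"

definition grad :: "('a \<Rightarrow> real) \<Rightarrow> 'a \<times> 'a \<Rightarrow> real" where
  "grad f = (\<lambda>(x, y). f y - f x)"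

definition grad_energy ::
  "'a measure \<Rightarrow> ('a \<Rightarrow> 'a measure) \<Rightarrow> real \<Rightarrow> 'a set \<Rightarrow> ('a \<Rightarrow> real) \<Rightarrow> ennreal" where
  "grad_energy \<nu> m p \<Omega> f =
     (\<integral>\<^sup>+z \<in> m_closure \<nu> m \<Omega> \<times> m_closure \<nu> m \<Omega>. ennreal (\<bar>grad f z\<bar> powr p) \<partial>step_measure \<nu> m)"

definition poincare_inequality ::
  "'a measure \<Rightarrow> ('a \<Rightarrow> 'a measure) \<Rightarrow> real \<Rightarrow> 'a set \<Rightarrow> bool" where
  "poincare_inequality \<nu> m p \<Omega> \<longleftrightarrow> (\<exists>c>0. \<forall>f\<in>Lp0 \<nu> m p \<Omega>.
     ennreal c * (\<integral>\<^sup>+x\<in>\<Omega>. ennreal (\<bar>f x\<bar> powr p) \<partial>\<nu>) \<le> grad_energy \<nu> m p \<Omega> f)"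

text \<open>
  Since functions stand for their classes, removing the zero of \<open>L\<^sup>p\<close> means
  removing all functions that vanish almost everywhere.
\<close>

definition lambda_mp :: "'a measure \<Rightarrow> ('a \<Rightarrow> 'a measure) \<Rightarrow> real \<Rightarrow> 'a set \<Rightarrow> ennreal" where
  "lambda_mp \<nu> m p \<Omega> =
     (INF f \<in> {f \<in> Lp0 \<nu> m p \<Omega>. \<not> (AE x in \<nu>. x \<in> m_closure \<nu> m \<Omega> \<longrightarrow> f x = 0)}.
        (1 / 2 * grad_energy \<nu> m p \<Omega> f) / (\<integral>\<^sup>+x\<in>\<Omega>. ennreal (\<bar>f x\<bar> powr p) \<partial>\<nu>))"

definition cheeger_const :: "'a measure \<Rightarrow> ('a \<Rightarrow> 'a measure) \<Rightarrow> 'a set \<Rightarrow> ennreal" where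
  "cheeger_const \<nu> m \<Omega> =
     (INF E \<in> {E \<in> sets \<nu>. E \<subseteq> \<Omega> \<and> emeasure \<nu> E > 0}. m_perimeter \<nu> m E / emeasure \<nu> E)"

text \<open>Real powers of extended nonnegative reals, meant for exponents \<open>p > 0\<close>.\<close>

definition ennreal_powr :: "ennreal \<Rightarrow> real \<Rightarrow> ennreal" where
  "ennreal_powr x p = (if x = \<infinity> then \<infinity> else ennreal (enn2real x powr p))"

end

theory Submission
  imports Defs
begin

text \<open>
  Indicators of subsets of \<open>\<Omega>\<close> have the same energy for every exponent, so the Cheeger constant \<open>h\<close>
  bounds every \<open>\<lambda>\<^sub>p\<close> from above. Conversely, the coarea formula gives
  \<open>h * \<integral>g \<le> 1/2 * \<integral>\<bar>\<nabla>g\<bar>\<close> for \<open>g \<ge> 0\<close> supported in \<open>\<Omega>\<close>, hence \<open>\<lambda>\<^sub>1 = h\<close>. Applying this to \<open>g powr p\<close>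
  and bounding \<open>\<bar>\<nabla>(g powr p)\<bar>\<close> pointwise by \<open>c powr (1 - p) * \<bar>\<nabla>g\<bar> powr p\<close> plus
  \<open>(p - 1) * c * (g(x) powr p + g(y) powr p)\<close> with \<open>c = h / p\<close>, which replaces Hoelder's inequality,
  the last term is absorbed and \<open>(h / p) powr p \<le> \<lambda>\<^sub>p\<close> follows.
\<close>

section \<open>Pointwise inequalities for real powers\<close>

text \<open>Weighted AM-GM for \<open>u powr p\<close> and 1, with weights \<open>1 / p\<close> and
  \<open>1 - 1 / p\<close>, bounds \<open>u\<close>; multiplying by \<open>p\<close> gives the
  tangent line at 1.\<close>

lemma powr_ge_tangent:
  fixes u p :: real
  assumes "0 \<le> u" "1 \<le> p"
  shows "1 + p * (u - 1) \<le> u powr p"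
proof (cases "u = 0")
  case False
  then have "(u powr p) powr (1 / p) * 1 powr (1 - 1 / p) \<le> 1 / p * u powr p + (1 - 1 / p) * 1"
    using assms by (intro Youngs_inequality_0) (auto simp: field_simps)
  then have "u \<le> 1 / p * u powr p + (1 - 1 / p)"
    using assms by (simp add: powr_powr)
  then have "p * u \<le> p * (1 / p * u powr p + (1 - 1 / p))"
    using assms by (intro mult_left_mono) auto
  also have "\<dots> = u powr p + p - 1"
    using assms by (simp add: field_simps)
  finally show ?thesis
    by (simp add: algebra_simps)
qed (use assms in auto)

text \<open>Two tangent line estimates for \<open>u \<mapsto> u powr p\<close>, at \<open>a / b\<close> and at \<open>(b - a) / (c * b)\<close>.\<close>

lemma powr_diff_le_Young:
  fixes a b c p :: real
  assumes "0 \<le> a" "a \<le> b" "0 < c" "1 \<le> p"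
  shows "b powr p - a powr p \<le> c powr (1 - p) * (b - a) powr p + (p - 1) * c * b powr p"
proof (cases "b = 0")
  case False
  then have b: "0 < b"
    using assms by auto
  have "b powr p * (1 + p * (a / b - 1)) \<le> b powr p * (a / b) powr p"
    using assms b by (intro mult_left_mono powr_ge_tangent) auto
  also have "\<dots> = a powr p"
    using assms b by (simp add: powr_divide)
  finally have 1: "b powr p - a powr p \<le> p * (1 - a / b) * b powr p"
    by (simp add: algebra_simps)
  have "(c * b powr p) * (1 + p * ((b - a) / (c * b) - 1)) \<le> (c * b powr p) * ((b - a) / (c * b)) powr p"
    using assms b by (intro mult_left_mono powr_ge_tangent) auto
  also have "\<dots> = c powr (1 - p) * (b - a) powr p"
    using assms b by (simp add: powr_divide powr_mult powr_diff field_simps)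
  also have "(c * b powr p) * (1 + p * ((b - a) / (c * b) - 1))
      = p * (1 - a / b) * b powr p - (p - 1) * c * b powr p"
    using assms b by (simp add: field_simps)
  finally show ?thesis
    using 1 by linarith
qed (use assms in auto)

text \<open>By symmetry one may order the two arguments. Adding the power of the smaller one only
  weakens the one-sided bound and makes the error term symmetric, so that each summand can be
  integrated through one marginal of the step measure.\<close>

lemma abs_powr_diff_le_Young:
  fixes a b c p :: real
  assumes "0 \<le> a" "0 \<le> b" "0 < c" "1 \<le> p"
  shows "\<bar>b powr p - a powr p\<bar> \<le> c powr (1 - p) * \<bar>b - a\<bar> powr p + (p - 1) * c * (a powr p + b powr p)"
proof -
  have *: "\<bar>y powr p - x powr p\<bar> \<le> c powr (1 - p) * \<bar>y - x\<bar> powr p + (p - 1) * c * (x powr p + y powr p)"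
    if "0 \<le> x" "x \<le> y" for x y :: real
  proof -
    have "x powr p \<le> y powr p"
      using that assms by (intro powr_mono2) auto
    moreover have "0 \<le> (p - 1) * c * x powr p"
      using assms by simp
    ultimately show ?thesis
      using powr_diff_le_Young[OF that assms(3,4)] that by (simp add: ring_distribs)
  qed
  show ?thesis
    using *[of a b] *[of b a] assms by (cases "a \<le> b") (auto simp: abs_minus_commute add.commute)
qed

section \<open>Symmetry, marginals and null sets of the step measure\<close>

context reversible_random_walk_space
begin

lemma kernel_subprob [measurable]: "m \<in> measurable \<nu> (subprob_algebra \<nu>)"
  using kernel by (rule measurable_prob_algebraD)

lemma sets_kernel: "x \<in> space \<nu> \<Longrightarrow> sets (m x) = sets \<nu>"
  using measurable_space[OF kernel] by (simp add: space_prob_algebra)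

lemma prob_space_kernel: "x \<in> space \<nu> \<Longrightarrow> prob_space (m x)"
  using measurable_space[OF kernel] by (simp add: space_prob_algebra)

lemma emeasure_kernel_space: "x \<in> space \<nu> \<Longrightarrow> emeasure (m x) (space \<nu>) = 1"
  using prob_space.emeasure_space_1[OF prob_space_kernel] sets_eq_imp_space_eq[OF sets_kernel]
  by metis

lemma sets_step_measure [measurable_cong]: "sets (step_measure \<nu> m) = sets (\<nu> \<Otimes>\<^sub>M \<nu>)"
  by (subst reversible) simp

lemma space_step_measure: "space (step_measure \<nu> m) = space \<nu> \<times> space \<nu>"
  using sets_eq_imp_space_eq[OF sets_step_measure] by (simp add: space_pair_measure)

text \<open>Reversibility as a change of variables: the step measure is its own image under exchange
  of coordinates.\<close>

lemma nn_integral_step_measure_swap: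
  assumes [measurable]: "f \<in> borel_measurable (\<nu> \<Otimes>\<^sub>M \<nu>)"
  shows "(\<integral>\<^sup>+z. f (snd z, fst z) \<partial>step_measure \<nu> m) = (\<integral>\<^sup>+z. f z \<partial>step_measure \<nu> m)"
proof -
  have "(\<integral>\<^sup>+z. f z \<partial>step_measure \<nu> m)
      = (\<integral>\<^sup>+z. f z \<partial>distr (step_measure \<nu> m) (\<nu> \<Otimes>\<^sub>M \<nu>) (\<lambda>(x, y). (y, x)))"
    using reversible by simp
  also have "\<dots> = (\<integral>\<^sup>+z. f (snd z, fst z) \<partial>step_measure \<nu> m)"
    by (subst nn_integral_distr) (auto simp: case_prod_beta)
  finally show ?thesis ..
qed

text \<open>Each \<open>m x\<close> has total mass 1, so the first marginal is \<open>\<nu>\<close>;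
  reversibility then makes the second marginal \<open>\<nu>\<close> as well.\<close>

lemma nn_integral_step_measure_fst:
  assumes [measurable]: "f \<in> borel_measurable \<nu>"
  shows "(\<integral>\<^sup>+z. f (fst z) \<partial>step_measure \<nu> m) = (\<integral>\<^sup>+x. f x \<partial>\<nu>)"
  by (subst nn_integral_step_measure[OF kernel])
     (auto intro!: nn_integral_cong simp: emeasure_kernel_space
       sets_eq_imp_space_eq[OF sets_kernel])

lemma nn_integral_step_measure_snd:
  assumes [measurable]: "f \<in> borel_measurable \<nu>"
  shows "(\<integral>\<^sup>+z. f (snd z) \<partial>step_measure \<nu> m) = (\<integral>\<^sup>+x. f x \<partial>\<nu>)"
  using nn_integral_step_measure_swap[of "\<lambda>z. f (fst z)"] nn_integral_step_measure_fst[OF assms]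
  by simp

lemma emeasure_step_measure_Times:
  assumes [measurable]: "A \<in> sets \<nu>" "B \<in> sets \<nu>"
  shows "emeasure (step_measure \<nu> m) (A \<times> B) = interaction \<nu> m A B"
proof -
  have "emeasure (step_measure \<nu> m) (A \<times> B) = (\<integral>\<^sup>+z. indicator (A \<times> B) z \<partial>step_measure \<nu> m)"
    by (subst nn_integral_indicator) auto
  also have "\<dots> = (\<integral>\<^sup>+x. \<integral>\<^sup>+y. indicator (A \<times> B) (x, y) \<partial>m x \<partial>\<nu>)"
    by (rule nn_integral_step_measure[OF kernel]) measurable
  also have "\<dots> = interaction \<nu> m A B"
    unfolding interaction_def
  proof (intro nn_integral_cong)
    fix x assume x: "x \<in> space \<nu>"
    have "(\<integral>\<^sup>+y. indicator (A \<times> B) (x, y) \<partial>m x) = (\<integral>\<^sup>+y. indicator A x * indicator B y \<partial>m x)"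
      by (simp add: indicator_times)
    also have "\<dots> = indicator A x * emeasure (m x) B"
      using assms sets_kernel[OF x] by (subst nn_integral_cmult_indicator) auto
    finally show "(\<integral>\<^sup>+y. indicator (A \<times> B) (x, y) \<partial>m x) = emeasure (m x) B * indicator A x"
      by (simp add: mult.commute)
  qed
  finally show ?thesis .
qed

text \<open>If \<open>N\<close> is \<open>\<nu>\<close>-null, the pairs with first or second
  coordinate in \<open>N\<close> form a null set, since both marginals are
  \<open>\<nu>\<close>.\<close>

lemma AE_step_measure:
  assumes "AE x in \<nu>. P x"
  shows "AE z in step_measure \<nu> m. P (fst z) \<and> P (snd z)"
proof -
  obtain N where N: "N \<in> null_sets \<nu>" "{x \<in> space \<nu>. \<not> P x} \<subseteq> N"
    using assms by (auto elim!: AE_E simp: null_sets_def)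
  then have [measurable]: "N \<in> sets \<nu>"
    by auto
  have "(\<integral>\<^sup>+z. indicator N (fst z) \<partial>step_measure \<nu> m) = 0"
    using N by (subst nn_integral_step_measure_fst) auto
  then have 1: "AE z in step_measure \<nu> m. fst z \<notin> N"
    by (subst (asm) nn_integral_0_iff_AE) (auto simp: indicator_eq_0_iff)
  have "(\<integral>\<^sup>+z. indicator N (snd z) \<partial>step_measure \<nu> m) = 0"
    using N by (subst nn_integral_step_measure_snd) auto
  then have 2: "AE z in step_measure \<nu> m. snd z \<notin> N"
    by (subst (asm) nn_integral_0_iff_AE) (auto simp: indicator_eq_0_iff)
  show ?thesis
    using 1 2 AE_space by eventually_elim (use N(2) in \<open>auto simp: space_step_measure\<close>)
qed

text \<open>Needed for Fubini against \<open>lborel\<close>. A countable cover by sets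
  \<open>a\<close> of finite measure yields the strips \<open>a \<times> space \<nu>\<close>, which
  have the same measure because the kernel has mass 1.\<close>

lemma sigma_finite_step_measure: "sigma_finite_measure (step_measure \<nu> m)"
proof
  obtain A where A: "countable A" "A \<subseteq> sets \<nu>" "\<Union>A = space \<nu>" "\<And>a. a \<in> A \<Longrightarrow> emeasure \<nu> a \<noteq> \<infinity>"
    using sigma_finite_countable by blast
  have "emeasure (step_measure \<nu> m) (a \<times> space \<nu>) = emeasure \<nu> a" if "a \<in> A" for a
  proof -
    have [measurable]: "a \<in> sets \<nu>" using A that by auto
    have "interaction \<nu> m a (space \<nu>) = (\<integral>\<^sup>+x. indicator a x \<partial>\<nu>)"
      unfolding interaction_def by (intro nn_integral_cong) (simp add: emeasure_kernel_space)
    then show ?thesis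
      by (simp add: emeasure_step_measure_Times)
  qed
  then show "\<exists>B. countable B \<and> B \<subseteq> sets (step_measure \<nu> m) \<and> \<Union>B = space (step_measure \<nu> m)
      \<and> (\<forall>b\<in>B. emeasure (step_measure \<nu> m) b \<noteq> \<infinity>)"
    using A by (intro exI[of _ "(\<lambda>a. a \<times> space \<nu>) ` A"])
      (auto simp: sets_step_measure space_step_measure)
qed

lemma sets_m_boundary [measurable]:
  assumes [measurable]: "\<Omega> \<in> sets \<nu>"
  shows "m_boundary \<nu> m \<Omega> \<in> sets \<nu>"
  unfolding m_boundary_def by measurable

lemma sets_m_closure [measurable]:
  assumes [measurable]: "\<Omega> \<in> sets \<nu>"
  shows "m_closure \<nu> m \<Omega> \<in> sets \<nu>"
  unfolding m_closure_def by measurable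

text \<open>By definition of the boundary, a point outside the closure steps into
  \<open>\<Omega>\<close> with probability 0; reversibility transfers this to steps that leave
  \<open>\<Omega>\<close> and land outside the closure.\<close>

lemma AE_step_m_closure:
  assumes [measurable]: "\<Omega> \<in> sets \<nu>"
  shows "AE z in step_measure \<nu> m. (fst z \<in> \<Omega> \<or> snd z \<in> \<Omega>) \<longrightarrow> z \<in> m_closure \<nu> m \<Omega> \<times> m_closure \<nu> m \<Omega>"
proof -
  let ?C = "m_closure \<nu> m \<Omega>"
  define F :: "'a \<times> 'a \<Rightarrow> ennreal" where "F = indicator ((space \<nu> - ?C) \<times> \<Omega>)"
  have [measurable]: "F \<in> borel_measurable (\<nu> \<Otimes>\<^sub>M \<nu>)"
    unfolding F_def by measurable
  have "interaction \<nu> m (space \<nu> - ?C) \<Omega> = (\<integral>\<^sup>+x. 0 \<partial>\<nu>)"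
    unfolding interaction_def
    by (intro nn_integral_cong) (auto simp: m_closure_def m_boundary_def split: split_indicator)
  then have 0: "(\<integral>\<^sup>+z. F z \<partial>step_measure \<nu> m) = 0"
    unfolding F_def by (subst nn_integral_indicator) (auto simp: emeasure_step_measure_Times)
  then have 1: "AE z in step_measure \<nu> m. F z = 0"
    by (subst (asm) nn_integral_0_iff_AE) auto
  have "(\<integral>\<^sup>+z. F (snd z, fst z) \<partial>step_measure \<nu> m) = 0"
    using 0 by (simp add: nn_integral_step_measure_swap)
  then have 2: "AE z in step_measure \<nu> m. F (snd z, fst z) = 0"
    by (subst (asm) nn_integral_0_iff_AE) auto
  show ?thesis
    using 1 2 AE_space
    by eventually_elim (auto simp: F_def space_step_measure indicator_eq_0_iff m_closure_def)
qed

section \<open>Coarea formula and layer cake representation\<close>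

text \<open>Since \<open>ennreal\<close> sends negative reals to 0, the left integrand is the
  positive part of the difference. It is the length of the set of levels \<open>t\<close> with
  \<open>g (snd z) \<le> t < g (fst z)\<close>, that is, of those whose superlevel set the step
  leaves. Fubini then exchanges levels and steps.\<close>

lemma coarea_step_measure:
  fixes g :: "'a \<Rightarrow> real"
  assumes [measurable]: "g \<in> borel_measurable \<nu>"
  shows "(\<integral>\<^sup>+z. ennreal (g (fst z) - g (snd z)) \<partial>step_measure \<nu> m)
    = (\<integral>\<^sup>+t. m_perimeter \<nu> m {x \<in> space \<nu>. t < g x} \<partial>lborel)"
proof -
  interpret S: sigma_finite_measure "step_measure \<nu> m"
    by (rule sigma_finite_step_measure)
  interpret pair_sigma_finite "step_measure \<nu> m" lborel ..
  define F :: "'a \<times> 'a \<Rightarrow> real \<Rightarrow> ennreal"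
    where "F = (\<lambda>z t. if g (snd z) \<le> t \<and> t < g (fst z) then 1 else 0)"
  have [measurable]: "case_prod F \<in> borel_measurable (step_measure \<nu> m \<Otimes>\<^sub>M lborel)"
    unfolding F_def by measurable
  have "(\<integral>\<^sup>+z. ennreal (g (fst z) - g (snd z)) \<partial>step_measure \<nu> m)
      = (\<integral>\<^sup>+z. \<integral>\<^sup>+t. F z t \<partial>lborel \<partial>step_measure \<nu> m)"
  proof (intro nn_integral_cong)
    fix z
    have "(\<integral>\<^sup>+t. F z t \<partial>lborel) = (\<integral>\<^sup>+t. indicator {g (snd z)..<g (fst z)} t \<partial>lborel)"
      by (intro nn_integral_cong) (auto simp: F_def)
    then show "ennreal (g (fst z) - g (snd z)) = (\<integral>\<^sup>+t. F z t \<partial>lborel)"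
      by (cases "g (snd z) \<le> g (fst z)") (auto simp: ennreal_neg)
  qed
  also have "\<dots> = (\<integral>\<^sup>+t. \<integral>\<^sup>+z. F z t \<partial>step_measure \<nu> m \<partial>lborel)"
    by (rule Fubini'[symmetric]) measurable
  also have "\<dots> = (\<integral>\<^sup>+t. m_perimeter \<nu> m {x \<in> space \<nu>. t < g x} \<partial>lborel)"
  proof (intro nn_integral_cong)
    fix t :: real
    let ?E = "{x \<in> space \<nu>. t < g x}"
    have "(\<integral>\<^sup>+z. F z t \<partial>step_measure \<nu> m)
        = (\<integral>\<^sup>+z. indicator (?E \<times> (space \<nu> - ?E)) z \<partial>step_measure \<nu> m)"
      by (intro nn_integral_cong) (auto simp: F_def space_step_measure split: split_indicator)
    also have "\<dots> = emeasure (step_measure \<nu> m) (?E \<times> (space \<nu> - ?E))"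
      by (intro nn_integral_indicator) measurable
    finally show "(\<integral>\<^sup>+z. F z t \<partial>step_measure \<nu> m) = m_perimeter \<nu> m ?E"
      by (simp add: emeasure_step_measure_Times m_perimeter_def)
  qed
  finally show ?thesis .
qed

text \<open>As in the coarea formula, \<open>g x\<close> is the length of the set of levels in
  \<open>{0..<g x}\<close>. Only nonnegative levels are counted, as superlevel sets of negative
  levels are the whole space.\<close>

lemma layer_cake:
  fixes g :: "'a \<Rightarrow> real"
  assumes [measurable]: "g \<in> borel_measurable \<nu>" and "\<And>x. 0 \<le> g x"
  shows "(\<integral>\<^sup>+x. ennreal (g x) \<partial>\<nu>)
    = (\<integral>\<^sup>+t\<in>{0..}. emeasure \<nu> {x \<in> space \<nu>. t < g x} \<partial>lborel)"
proof -
  interpret pair_sigma_finite \<nu> lborel ..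
  define F :: "'a \<Rightarrow> real \<Rightarrow> ennreal"
    where "F = (\<lambda>x t. if 0 \<le> t \<and> t < g x then 1 else 0)"
  have [measurable]: "case_prod F \<in> borel_measurable (\<nu> \<Otimes>\<^sub>M lborel)"
    unfolding F_def by measurable
  have "(\<integral>\<^sup>+x. ennreal (g x) \<partial>\<nu>) = (\<integral>\<^sup>+x. \<integral>\<^sup>+t. F x t \<partial>lborel \<partial>\<nu>)"
  proof (intro nn_integral_cong)
    fix x
    have "(\<integral>\<^sup>+t. F x t \<partial>lborel) = (\<integral>\<^sup>+t. indicator {0..<g x} t \<partial>lborel)"
      by (intro nn_integral_cong) (auto simp: F_def)
    then show "ennreal (g x) = (\<integral>\<^sup>+t. F x t \<partial>lborel)"
      using assms(2)[of x] by simp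
  qed
  also have "\<dots> = (\<integral>\<^sup>+t. \<integral>\<^sup>+x. F x t \<partial>\<nu> \<partial>lborel)"
    by (rule Fubini'[symmetric]) measurable
  also have "\<dots> = (\<integral>\<^sup>+t\<in>{0..}. emeasure \<nu> {x \<in> space \<nu>. t < g x} \<partial>lborel)"
  proof (intro nn_integral_cong)
    fix t :: real
    let ?E = "{x \<in> space \<nu>. t < g x}"
    have "(\<integral>\<^sup>+x. F x t \<partial>\<nu>) = (\<integral>\<^sup>+x. indicator {0..} t * indicator ?E x \<partial>\<nu>)"
      by (intro nn_integral_cong) (auto simp: F_def split: split_indicator)
    also have "\<dots> = indicator {0..} t * emeasure \<nu> ?E"
      by (intro nn_integral_cmult_indicator) measurable
    finally show "(\<integral>\<^sup>+x. F x t \<partial>\<nu>) = emeasure \<nu> ?E * indicator {0..} t"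
      by (simp add: mult.commute)
  qed
  finally show ?thesis .
qed

section \<open>The Cheeger inequality for functions\<close>

text \<open>The product form also covers null sets, which are not competitors in the infimum but do
  occur as superlevel sets. Finiteness of the measure allows the quotient to be cleared.\<close>

lemma cheeger_const_mult_le_perimeter:
  assumes "E \<in> sets \<nu>" "E \<subseteq> \<Omega>" "emeasure \<nu> \<Omega> < \<infinity>" "\<Omega> \<in> sets \<nu>"
  shows "cheeger_const \<nu> m \<Omega> * emeasure \<nu> E \<le> m_perimeter \<nu> m E"
proof (cases "emeasure \<nu> E = 0")
  case False
  have fin: "emeasure \<nu> E \<noteq> \<infinity>"
    using emeasure_mono[OF assms(2,4)] assms(3) by (auto simp: top_unique)
  have "cheeger_const \<nu> m \<Omega> \<le> m_perimeter \<nu> m E / emeasure \<nu> E"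
    unfolding cheeger_const_def using assms False by (intro INF_lower) (auto simp: zero_less_iff_neq_zero)
  then have "cheeger_const \<nu> m \<Omega> * emeasure \<nu> E \<le> m_perimeter \<nu> m E / emeasure \<nu> E * emeasure \<nu> E"
    by (rule mult_right_mono) simp
  also have "\<dots> = m_perimeter \<nu> m E"
    using False fin by (simp add: ennreal_divide_times less_top)
  finally show ?thesis .
qed simp

text \<open>The absolute value is the sum of the positive parts of both differences, and these have
  equal integrals by reversibility.\<close>

lemma nn_integral_abs_diff_step_measure:
  fixes g :: "'a \<Rightarrow> real"
  assumes [measurable]: "g \<in> borel_measurable \<nu>"
  shows "(\<integral>\<^sup>+z. ennreal \<bar>g (snd z) - g (fst z)\<bar> \<partial>step_measure \<nu> m)
    = 2 * (\<integral>\<^sup>+z. ennreal (g (fst z) - g (snd z)) \<partial>step_measure \<nu> m)"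
proof -
  have "(\<integral>\<^sup>+z. ennreal \<bar>g (snd z) - g (fst z)\<bar> \<partial>step_measure \<nu> m)
      = (\<integral>\<^sup>+z. ennreal (g (fst z) - g (snd z)) + ennreal (g (snd z) - g (fst z)) \<partial>step_measure \<nu> m)"
    by (intro nn_integral_cong) (auto simp: abs_if ennreal_neg)
  also have "\<dots> = (\<integral>\<^sup>+z. ennreal (g (fst z) - g (snd z)) \<partial>step_measure \<nu> m)
      + (\<integral>\<^sup>+z. ennreal (g (snd z) - g (fst z)) \<partial>step_measure \<nu> m)"
    by (intro nn_integral_add) measurable
  also have "(\<integral>\<^sup>+z. ennreal (g (snd z) - g (fst z)) \<partial>step_measure \<nu> m)
      = (\<integral>\<^sup>+z. ennreal (g (fst z) - g (snd z)) \<partial>step_measure \<nu> m)"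
    using nn_integral_step_measure_swap[of "\<lambda>z. ennreal (g (fst z) - g (snd z))"] by simp
  finally show ?thesis
    by (simp add: mult_2)
qed

text \<open>Layer cake on the left and coarea on the right reduce the claim to single levels. For
  \<open>0 \<le> t\<close> the superlevel set lies in \<open>\<Omega>\<close> and competes for the
  Cheeger constant; for \<open>t < 0\<close> the left integrand is 0.\<close>

lemma cheeger_inequality:
  fixes g :: "'a \<Rightarrow> real"
  assumes [measurable]: "g \<in> borel_measurable \<nu>" "\<Omega> \<in> sets \<nu>"
    and "emeasure \<nu> \<Omega> < \<infinity>" and g: "\<And>x. 0 \<le> g x" "\<And>x. x \<notin> \<Omega> \<Longrightarrow> g x = 0"
  shows "2 * (cheeger_const \<nu> m \<Omega> * (\<integral>\<^sup>+x. ennreal (g x) \<partial>\<nu>))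
    \<le> (\<integral>\<^sup>+z. ennreal \<bar>g (snd z) - g (fst z)\<bar> \<partial>step_measure \<nu> m)"
proof -
  have "cheeger_const \<nu> m \<Omega> * (\<integral>\<^sup>+x. ennreal (g x) \<partial>\<nu>)
      = (\<integral>\<^sup>+t. cheeger_const \<nu> m \<Omega> * (emeasure \<nu> {x \<in> space \<nu>. t < g x} * indicator {0..} t) \<partial>lborel)"
    unfolding layer_cake[OF assms(1) g(1)] by (intro nn_integral_cmult[symmetric]) measurable
  also have "\<dots> \<le> (\<integral>\<^sup>+t. m_perimeter \<nu> m {x \<in> space \<nu>. t < g x} \<partial>lborel)"
  proof (intro nn_integral_mono)
    fix t :: real
    have "{x \<in> space \<nu>. t < g x} \<subseteq> \<Omega>" if "0 \<le> t"
      using g that by force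
    then show "cheeger_const \<nu> m \<Omega> * (emeasure \<nu> {x \<in> space \<nu>. t < g x} * indicator {0..} t)
        \<le> m_perimeter \<nu> m {x \<in> space \<nu>. t < g x}"
      using cheeger_const_mult_le_perimeter[of "{x \<in> space \<nu>. t < g x}" \<Omega>] assms(2,3)
      by (auto split: split_indicator)
  qed
  finally show ?thesis
    unfolding nn_integral_abs_diff_step_measure[OF assms(1)] coarea_step_measure[OF assms(1)]
    by (rule mult_left_mono) simp
qed

text \<open>Testing with \<open>\<Omega>\<close> itself shows that the constant is finite, so that
  it may be handled as a real number.\<close>

lemma cheeger_const_le_1:
  assumes "\<Omega> \<in> sets \<nu>" "0 < emeasure \<nu> \<Omega>" "emeasure \<nu> \<Omega> < \<infinity>"
  shows "cheeger_const \<nu> m \<Omega> \<le> 1"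
proof -
  have "m_perimeter \<nu> m \<Omega> \<le> (\<integral>\<^sup>+x. indicator \<Omega> x \<partial>\<nu>)"
    unfolding m_perimeter_def interaction_def
  proof (intro nn_integral_mono)
    fix x assume x: "x \<in> space \<nu>"
    interpret prob_space "m x" using x by (rule prob_space_kernel)
    show "emeasure (m x) (space \<nu> - \<Omega>) * indicator \<Omega> x \<le> indicator \<Omega> x"
      by (auto split: split_indicator simp: measure_le_1)
  qed
  then have "m_perimeter \<nu> m \<Omega> / emeasure \<nu> \<Omega> \<le> 1"
    using assms by (intro divide_le_posI_ennreal) auto
  moreover have "cheeger_const \<nu> m \<Omega> \<le> m_perimeter \<nu> m \<Omega> / emeasure \<nu> \<Omega>"
    unfolding cheeger_const_def using assms by (intro INF_lower) auto
  ultimately show ?thesis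
    by (rule order.trans[rotated])
qed

section \<open>The Cheeger inequality for powers and the lower bound\<close>

lemma cheeger_inequality_powr:
  fixes g :: "'a \<Rightarrow> real" and p r :: real
  assumes [measurable]: "g \<in> borel_measurable \<nu>" "\<Omega> \<in> sets \<nu>"
    and "emeasure \<nu> \<Omega> < \<infinity>" and g: "\<And>x. 0 \<le> g x" "\<And>x. x \<notin> \<Omega> \<Longrightarrow> g x = 0"
    and p: "1 \<le> p" and r: "0 \<le> r" "cheeger_const \<nu> m \<Omega> = ennreal r"
    and fin: "(\<integral>\<^sup>+x. ennreal (g x powr p) \<partial>\<nu>) < \<infinity>"
  shows "2 * (ennreal ((r / p) powr p) * (\<integral>\<^sup>+x. ennreal (g x powr p) \<partial>\<nu>))
    \<le> (\<integral>\<^sup>+z. ennreal (\<bar>g (snd z) - g (fst z)\<bar> powr p) \<partial>step_measure \<nu> m)"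
    (is "2 * (_ * ?A) \<le> ?T")
\<comment> \<open>Both excluded cases are trivial. Otherwise \<open>c\<close> below is positive and
  all integrals are finite, which permits subtraction.\<close>
proof (cases "r = 0 \<or> ?T = \<infinity>")
  case False
  then have "0 < r" using r by auto
  \<comment> \<open>For \<open>p > 1\<close> this value maximizes
    \<open>c powr (p - 1) * (r - (p - 1) * c)\<close>, the constant left after absorbing the error
    term; the maximum is \<open>(r / p) powr p\<close>.\<close>
  define c where "c = r / p"
  have c: "0 < c" "r = c * p"
    using p \<open>0 < r\<close> by (auto simp: c_def)
  obtain a where a: "?A = ennreal a" "0 \<le> a"
    using fin by (cases ?A) auto
  obtain e where e: "?T = ennreal e" "0 \<le> e"
    using False by (cases ?T) auto
  have "2 * (ennreal r * ?A) \<le> (\<integral>\<^sup>+z. ennreal \<bar>g (snd z) powr p - g (fst z) powr p\<bar> \<partial>step_measure \<nu> m)"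
    using cheeger_inequality[of "\<lambda>x. g x powr p" \<Omega>] assms by simp
  also have "\<dots> \<le> (\<integral>\<^sup>+z. ennreal (c powr (1 - p)) * ennreal (\<bar>g (snd z) - g (fst z)\<bar> powr p)
      + ennreal ((p - 1) * c) * (ennreal (g (fst z) powr p) + ennreal (g (snd z) powr p)) \<partial>step_measure \<nu> m)"
  proof (intro nn_integral_mono)
    fix z :: "'a \<times> 'a"
    have "ennreal \<bar>g (snd z) powr p - g (fst z) powr p\<bar>
        \<le> ennreal (c powr (1 - p) * \<bar>g (snd z) - g (fst z)\<bar> powr p
          + (p - 1) * c * (g (fst z) powr p + g (snd z) powr p))"
      by (intro ennreal_leI abs_powr_diff_le_Young g(1) c(1) p)
    then show "ennreal \<bar>g (snd z) powr p - g (fst z) powr p\<bar>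
        \<le> ennreal (c powr (1 - p)) * ennreal (\<bar>g (snd z) - g (fst z)\<bar> powr p)
          + ennreal ((p - 1) * c) * (ennreal (g (fst z) powr p) + ennreal (g (snd z) powr p))"
      using c(1) p by (simp add: ennreal_mult ennreal_plus)
  qed
  also have "\<dots> = ennreal (c powr (1 - p)) * ?T + ennreal ((p - 1) * c) * (2 * ?A)"
    using nn_integral_step_measure_fst[of "\<lambda>x. ennreal (g x powr p)"]
      nn_integral_step_measure_snd[of "\<lambda>x. ennreal (g x powr p)"]
    by (simp add: nn_integral_add nn_integral_cmult mult_2)
  finally have "ennreal (2 * (r * a)) \<le> ennreal (c powr (1 - p) * e + (p - 1) * c * (2 * a))"
    using a e c p r by (simp add: ennreal_mult ennreal_plus)
  then have "2 * (r * a) \<le> c powr (1 - p) * e + (p - 1) * c * (2 * a)"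
    using a e c p by (subst (asm) ennreal_le_iff) auto
  \<comment> \<open>As \<open>r = c * p\<close>, the left side \<open>2 * (r * a)\<close> exceeds
    the error term by exactly \<open>2 * (c * a)\<close>.\<close>
  then have "2 * (c * a) \<le> c powr (1 - p) * e"
    unfolding c(2) by (simp add: algebra_simps)
  then have "c powr (p - 1) * (2 * (c * a)) \<le> c powr (p - 1) * (c powr (1 - p) * e)"
    by (intro mult_left_mono) auto
  then have "2 * (c powr p * a) \<le> e"
    using c(1) by (simp add: powr_diff field_simps)
  then show ?thesis
    using a e by (auto simp: c_def[symmetric] ennreal_mult[symmetric] simp flip: ennreal_numeral)
qed (use p in auto)

text \<open>
  Replacing \<open>f\<close> by the absolute value of its restriction to \<open>\<Omega>\<close> does not increase the energy,
  because a step from \<open>\<Omega>\<close> almost surely ends in the closure and vice versa.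
\<close>

lemma Lp0_nonneg_representative:
  assumes [measurable]: "\<Omega> \<in> sets \<nu>" and f: "f \<in> Lp0 \<nu> m p \<Omega>" and p: "0 < p"
  obtains g :: "'a \<Rightarrow> real" where "g \<in> borel_measurable \<nu>" "\<And>x. 0 \<le> g x" "\<And>x. x \<notin> \<Omega> \<Longrightarrow> g x = 0"
    "(\<integral>\<^sup>+x\<in>\<Omega>. ennreal (\<bar>f x\<bar> powr p) \<partial>\<nu>) = (\<integral>\<^sup>+x. ennreal (g x powr p) \<partial>\<nu>)"
    "(\<integral>\<^sup>+x. ennreal (g x powr p) \<partial>\<nu>) < \<infinity>"
    "(\<integral>\<^sup>+z. ennreal (\<bar>g (snd z) - g (fst z)\<bar> powr p) \<partial>step_measure \<nu> m) \<le> grad_energy \<nu> m p \<Omega> f"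
proof
  let ?C = "m_closure \<nu> m \<Omega>"
  define g where "g = (\<lambda>x. indicator \<Omega> x *\<^sub>R \<bar>f x\<bar>)"
  have "f \<in> borel_measurable (restrict_space \<nu> ?C)"
    using f by (simp add: Lp0_def)
  \<comment> \<open>Measurability of \<open>f\<close> is known on the closure only, so it is passed
    to \<open>g\<close> through the extension of \<open>f\<close> by zero.\<close>
  then have "(\<lambda>x. indicator ?C x *\<^sub>R f x) \<in> borel_measurable \<nu>"
    by (subst (asm) borel_measurable_restrict_space_iff) auto
  then have "(\<lambda>x. indicator \<Omega> x *\<^sub>R \<bar>indicator ?C x *\<^sub>R f x\<bar>) \<in> borel_measurable \<nu>"
    by measurable
  also have "(\<lambda>x. indicator \<Omega> x *\<^sub>R \<bar>indicator ?C x *\<^sub>R f x\<bar>) = g"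
    by (auto simp: g_def m_closure_def fun_eq_iff split: split_indicator)
  finally show "g \<in> borel_measurable \<nu>" .
  show "0 \<le> g x" for x
    by (simp add: g_def)
  show "g x = 0" if "x \<notin> \<Omega>" for x
    using that by (simp add: g_def)
  show eq: "(\<integral>\<^sup>+x\<in>\<Omega>. ennreal (\<bar>f x\<bar> powr p) \<partial>\<nu>) = (\<integral>\<^sup>+x. ennreal (g x powr p) \<partial>\<nu>)"
    using p by (intro nn_integral_cong) (auto simp: g_def split: split_indicator)
  have "(\<integral>\<^sup>+x\<in>\<Omega>. ennreal (\<bar>f x\<bar> powr p) \<partial>\<nu>) \<le> (\<integral>\<^sup>+x\<in>?C. ennreal (\<bar>f x\<bar> powr p) \<partial>\<nu>)"
    by (intro nn_integral_mono) (auto simp: m_closure_def split: split_indicator)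
  also have "\<dots> < \<infinity>"
    using f by (simp add: Lp0_def)
  finally show "(\<integral>\<^sup>+x. ennreal (g x powr p) \<partial>\<nu>) < \<infinity>"
    unfolding eq .
  have "AE x in \<nu>. x \<in> m_boundary \<nu> m \<Omega> \<longrightarrow> f x = 0"
    using f by (simp add: Lp0_def)
  then have "AE x in \<nu>. x \<in> ?C \<longrightarrow> g x = \<bar>f x\<bar>"
    by eventually_elim (auto simp: g_def m_closure_def split: split_indicator)
  from AE_step_measure[OF this] AE_step_m_closure[OF assms(1)]
  have "AE z in step_measure \<nu> m. ennreal (\<bar>g (snd z) - g (fst z)\<bar> powr p)
      \<le> ennreal (\<bar>grad f z\<bar> powr p) * indicator (?C \<times> ?C) z"
  proof eventually_elim
    case (elim z)
    show ?case
    proof (cases "z \<in> ?C \<times> ?C")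
      case True
      \<comment> \<open>Reverse triangle inequality, as \<open>g\<close> agrees with the absolute
        value of \<open>f\<close> at both endpoints.\<close>
      then have "\<bar>g (snd z) - g (fst z)\<bar> \<le> \<bar>grad f z\<bar>"
        using elim by (auto simp: grad_def case_prod_beta)
      then show ?thesis
        using True p by (auto intro!: ennreal_leI powr_mono2)
    next
      case False
      then have "g (fst z) = 0" "g (snd z) = 0"
        using elim by (auto simp: g_def)
      then show ?thesis
        by simp
    qed
  qed
  then show "(\<integral>\<^sup>+z. ennreal (\<bar>g (snd z) - g (fst z)\<bar> powr p) \<partial>step_measure \<nu> m) \<le> grad_energy \<nu> m p \<Omega> f"
    unfolding grad_energy_def by (rule nn_integral_mono_AE)
qed

text \<open>The previous inequality for the nonnegative representative is divided by the integral of
  \<open>\<bar>f x\<bar> powr p\<close>. For \<open>p = 1\<close> the bound is the Cheeger constant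
  itself.\<close>

lemma lambda_mp_ge:
  assumes [measurable]: "\<Omega> \<in> sets \<nu>" and fin: "emeasure \<nu> \<Omega> < \<infinity>"
    and p: "1 \<le> p" and r: "0 \<le> r" "cheeger_const \<nu> m \<Omega> = ennreal r"
  shows "ennreal ((r / p) powr p) \<le> lambda_mp \<nu> m p \<Omega>"
  unfolding lambda_mp_def
proof (intro INF_greatest)
  fix f assume "f \<in> {f \<in> Lp0 \<nu> m p \<Omega>. \<not> (AE x in \<nu>. x \<in> m_closure \<nu> m \<Omega> \<longrightarrow> f x = 0)}"
  then have f: "f \<in> Lp0 \<nu> m p \<Omega>" "\<not> (AE x in \<nu>. x \<in> m_closure \<nu> m \<Omega> \<longrightarrow> f x = 0)"
    by auto
  have "0 < p" using p by simp
  then obtain g :: "'a \<Rightarrow> real" where g [measurable]: "g \<in> borel_measurable \<nu>"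
    and g0: "\<And>x. 0 \<le> g x" "\<And>x. x \<notin> \<Omega> \<Longrightarrow> g x = 0"
    and A: "(\<integral>\<^sup>+x\<in>\<Omega>. ennreal (\<bar>f x\<bar> powr p) \<partial>\<nu>) = (\<integral>\<^sup>+x. ennreal (g x powr p) \<partial>\<nu>)"
      "(\<integral>\<^sup>+x. ennreal (g x powr p) \<partial>\<nu>) < \<infinity>"
    and T: "(\<integral>\<^sup>+z. ennreal (\<bar>g (snd z) - g (fst z)\<bar> powr p) \<partial>step_measure \<nu> m) \<le> grad_energy \<nu> m p \<Omega> f"
    by (rule Lp0_nonneg_representative[OF assms(1) f(1) _ that])
  let ?A = "\<integral>\<^sup>+x\<in>\<Omega>. ennreal (\<bar>f x\<bar> powr p) \<partial>\<nu>"
  \<comment> \<open>Otherwise \<open>f\<close> would vanish almost everywhere on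
    \<open>\<Omega>\<close> and, by its boundary condition, on the whole closure.\<close>
  have "?A \<noteq> 0"
  proof
    assume "?A = 0"
    moreover have "f \<in> borel_measurable (restrict_space \<nu> \<Omega>)"
      using f(1) by (auto simp: Lp0_def m_closure_def
        intro: measurable_restrict_mono)
    then have "(\<lambda>x. ennreal (\<bar>f x\<bar> powr p) * indicator \<Omega> x) \<in> borel_measurable \<nu>"
      by (subst borel_measurable_restrict_space_iff_ennreal[symmetric]) auto
    ultimately have "AE x in \<nu>. x \<in> \<Omega> \<longrightarrow> f x = 0"
      by (subst (asm) nn_integral_0_iff_AE) (auto split: split_indicator_asm simp: indicator_eq_0_iff)
    moreover have "AE x in \<nu>. x \<in> m_boundary \<nu> m \<Omega> \<longrightarrow> f x = 0"
      using f(1) by (simp add: Lp0_def)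
    ultimately have "AE x in \<nu>. x \<in> m_closure \<nu> m \<Omega> \<longrightarrow> f x = 0"
      by eventually_elim (auto simp: m_closure_def)
    then show False
      using f(2) by simp
  qed
  have "2 * (ennreal ((r / p) powr p) * ?A) \<le> grad_energy \<nu> m p \<Omega> f"
    using cheeger_inequality_powr[OF g assms(1) fin g0 p r A(2)] T A(1) by simp
  then have "1 / 2 * (2 * (ennreal ((r / p) powr p) * ?A)) \<le> 1 / 2 * grad_energy \<nu> m p \<Omega> f"
    by (rule mult_left_mono) simp
  also have "1 / 2 * (2 * (ennreal ((r / p) powr p) * ?A)) = ennreal ((r / p) powr p) * ?A"
    by (simp add: mult.assoc[symmetric] ennreal_divide_times)
  finally have "ennreal ((r / p) powr p) * ?A / ?A \<le> 1 / 2 * grad_energy \<nu> m p \<Omega> f / ?A"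
    by (rule divide_right_mono_ennreal)
  then show "ennreal ((r / p) powr p) \<le> 1 / 2 * grad_energy \<nu> m p \<Omega> f / ?A"
    using \<open>?A \<noteq> 0\<close> A by (simp add: mult_divide_eq_ennreal less_top)
qed

section \<open>The upper bound from indicator functions\<close>

text \<open>The gradient of an indicator has modulus 0 or 1, hence equals its powers in modulus. It
  is nonzero exactly on steps crossing between \<open>E\<close> and its complement, and the two
  directions have equal mass by reversibility. Restriction to the closure can only lower the
  energy.\<close>

lemma grad_energy_indicator_le:
  assumes [measurable]: "\<Omega> \<in> sets \<nu>" "E \<in> sets \<nu>"
  shows "grad_energy \<nu> m p \<Omega> (indicator E) \<le> 2 * m_perimeter \<nu> m E"
proof -
  let ?E' = "space \<nu> - E"
  have "grad_energy \<nu> m p \<Omega> (indicator E)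
      \<le> (\<integral>\<^sup>+z. indicator (E \<times> ?E') z + indicator (E \<times> ?E') (snd z, fst z) \<partial>step_measure \<nu> m)"
    unfolding grad_energy_def
    by (intro nn_integral_mono)
       (auto simp: grad_def space_step_measure indicator_def)
  also have "\<dots> = (\<integral>\<^sup>+z. indicator (E \<times> ?E') z \<partial>step_measure \<nu> m)
      + (\<integral>\<^sup>+z. indicator (E \<times> ?E') (snd z, fst z) \<partial>step_measure \<nu> m)"
    by (intro nn_integral_add) measurable
  also have "\<dots> = 2 * m_perimeter \<nu> m E"
    unfolding m_perimeter_def
    by (subst nn_integral_step_measure_swap, simp, subst (1 2) nn_integral_indicator)
       (auto simp: emeasure_step_measure_Times mult_2)
  finally show ?thesis .
qed

lemma lambda_mp_le_cheeger_const:
  assumes [measurable]: "\<Omega> \<in> sets \<nu>" and fin: "emeasure \<nu> \<Omega> < \<infinity>" and p: "0 < p"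
  shows "lambda_mp \<nu> m p \<Omega> \<le> cheeger_const \<nu> m \<Omega>"
  unfolding cheeger_const_def
proof (intro INF_greatest)
  fix E assume "E \<in> {E \<in> sets \<nu>. E \<subseteq> \<Omega> \<and> emeasure \<nu> E > 0}"
  then have [measurable]: "E \<in> sets \<nu>" and E: "E \<subseteq> \<Omega>" "emeasure \<nu> E > 0"
    by auto
  let ?C = "m_closure \<nu> m \<Omega>"
  let ?f = "indicator E :: 'a \<Rightarrow> real"
  have C: "\<Omega> \<subseteq> ?C"
    by (auto simp: m_closure_def)
  \<comment> \<open>Taken with the closure for membership in \<open>Lp0\<close> and with
    \<open>\<Omega>\<close> for the denominator of the quotient.\<close>
  have int: "(\<integral>\<^sup>+x\<in>S. ennreal (\<bar>?f x\<bar> powr p) \<partial>\<nu>) = emeasure \<nu> E" if "E \<subseteq> S" for S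
  proof -
    have "(\<integral>\<^sup>+x\<in>S. ennreal (\<bar>?f x\<bar> powr p) \<partial>\<nu>) = (\<integral>\<^sup>+x. indicator E x \<partial>\<nu>)"
      using that p by (intro nn_integral_cong) (auto split: split_indicator)
    then show ?thesis
      by simp
  qed
  have "emeasure \<nu> E < \<infinity>"
    using emeasure_mono[OF E(1) assms(1)] fin by simp
  then have "?f \<in> Lp0 \<nu> m p \<Omega>"
    unfolding Lp0_def using E(1) C int[of ?C]
    by (auto simp: m_boundary_def split: split_indicator intro!: measurable_restrict_space1)
  moreover have "\<not> (AE x in \<nu>. x \<in> ?C \<longrightarrow> ?f x = 0)"
  proof
    assume "AE x in \<nu>. x \<in> ?C \<longrightarrow> ?f x = 0"
    then have "AE x in \<nu>. x \<notin> E"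
      by eventually_elim (use E(1) C in \<open>auto simp: indicator_eq_0_iff\<close>)
    then have "emeasure \<nu> E = 0"
      by (subst (asm) AE_iff_measurable[OF _ refl]) (auto simp: sets.Int_space_eq2 Int_def[symmetric] Collect_conj_eq)
    then show False
      using E(2) by simp
  qed
  ultimately have "lambda_mp \<nu> m p \<Omega> \<le> (1 / 2 * grad_energy \<nu> m p \<Omega> ?f) / emeasure \<nu> E"
    unfolding lambda_mp_def using int[OF E(1)] by (intro INF_lower2[of ?f]) auto
  also have "\<dots> \<le> (1 / 2 * (2 * m_perimeter \<nu> m E)) / emeasure \<nu> E"
    by (intro divide_right_mono_ennreal mult_left_mono grad_energy_indicator_le) auto
  also have "1 / 2 * (2 * m_perimeter \<nu> m E) = m_perimeter \<nu> m E"
    by (simp add: mult.assoc[symmetric] ennreal_divide_times)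
  finally show "lambda_mp \<nu> m p \<Omega> \<le> m_perimeter \<nu> m E / emeasure \<nu> E" .
qed

end

theorem theorem6p14:
  fixes \<nu> :: "'a measure" and m :: "'a \<Rightarrow> 'a measure" and \<Omega> :: "'a set"
  assumes "reversible_random_walk_space \<nu> m"
    and "\<Omega> \<in> sets \<nu>"
    and "m_connected \<nu> m \<Omega>"
    and "0 < emeasure \<nu> \<Omega>"
    and "emeasure \<nu> \<Omega> < emeasure \<nu> (m_closure \<nu> m \<Omega>)"
    and "emeasure \<nu> (m_closure \<nu> m \<Omega>) < \<infinity>"
    and "\<forall>p>1. poincare_inequality \<nu> m p \<Omega>"
  shows "(\<forall>p>1. ennreal_powr (lambda_mp \<nu> m 1 \<Omega> / ennreal p) p \<le> lambda_mp \<nu> m p \<Omega> \<and>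
                lambda_mp \<nu> m p \<Omega> \<le> lambda_mp \<nu> m 1 \<Omega>)
       \<and> ((\<lambda>p. lambda_mp \<nu> m p \<Omega>) \<longlongrightarrow> lambda_mp \<nu> m 1 \<Omega>) (at_right 1)
       \<and> lambda_mp \<nu> m 1 \<Omega> = cheeger_const \<nu> m \<Omega>"
proof -
  interpret reversible_random_walk_space \<nu> m
    by fact
  have fin: "emeasure \<nu> \<Omega> < \<infinity>"
    using assms(5,6) by (rule less_trans)
  obtain r where r: "0 \<le> r" "cheeger_const \<nu> m \<Omega> = ennreal r"
    using cheeger_const_le_1[OF assms(2,4) fin] by (cases "cheeger_const \<nu> m \<Omega>") (auto simp: top_unique)
  have lower: "ennreal ((r / p) powr p) \<le> lambda_mp \<nu> m p \<Omega>" if "1 \<le> p" for p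
    using lambda_mp_ge[OF assms(2) fin that r] .
  have upper: "lambda_mp \<nu> m p \<Omega> \<le> ennreal r" if "1 \<le> p" for p
    using lambda_mp_le_cheeger_const[OF assms(2) fin, of p] that r(2) by simp
  \<comment> \<open>At \<open>p = 1\<close> the lower and upper bounds coincide.\<close>
  have l1: "lambda_mp \<nu> m 1 \<Omega> = ennreal r"
    using lower[of 1] upper[of 1] r(1) by simp
  have "((\<lambda>p. (r / p) powr p) \<longlongrightarrow> (r / 1) powr 1) (at_right 1)"
    using r(1) by (intro tendsto_intros) (auto simp: eventually_at_right_less intro: always_eventually)
  then have lim: "((\<lambda>p. ennreal ((r / p) powr p)) \<longlongrightarrow> ennreal r) (at_right 1)"
    using r(1) by (intro tendsto_ennrealI) simp
  \<comment> \<open>Squeezed between \<open>(r / p) powr p\<close>, which tends to \<open>r\<close>,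
    and the constant \<open>r\<close>.\<close>
  have "((\<lambda>p. lambda_mp \<nu> m p \<Omega>) \<longlongrightarrow> ennreal r) (at_right 1)"
    by (rule tendsto_sandwich[OF _ _ lim tendsto_const])
       (auto intro!: eventually_at_rightI[of 1 2] lower upper)
  moreover have "ennreal_powr (ennreal r / ennreal p) p = ennreal ((r / p) powr p)" if "1 < p" for p
    using that r(1) by (simp add: ennreal_powr_def divide_ennreal)
  ultimately show ?thesis
    unfolding l1 r(2) using lower upper by simp
qed

end
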